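(* If $G$ is a finite nilpotent group which is not a $p$-group (for any prime $p$), then the difference graph $D(G)$ is connected and $\operatorname{diam}(D(G))\leq 4$.
   Context: For a group $G$, the power graph $\mathsf{Pow}(G)$ has vertex set $G$, with distinct $a,b$ adjacent iff $a\in\langle b\rangle$ or $b\in\langle a\rangle$. The enhanced power graph $\mathsf{EPow}(G)$ has vertex set $G$, with distinct $a,b$ adjacent iff $\langle a,b\rangle$ is cyclic. The difference graph $D(G)$ is the graph $\mathsf{EPow}(G)-\mathsf{Pow}(G)$ with all isolated vertices removed; thus $x\sim y$ in $D(G)$ iff $\langle x,y\rangle$ is cyclic, $x\notin\langle y\rangle$ and $y\notin\langle x\rangle$. *)

theory Defs
  imports
    "HOL-Computational_Algebra.Primes"
    "HOL-Algebra.Elementary_Groups"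
    "HOL-Algebra.Generated_Groups"
    "Graph_Theory.Graph_Theory"
begin

section \<open>Groups\<close>

definition commutator_subgroup :: "('a, 'b) monoid_scheme \<Rightarrow> 'a set \<Rightarrow> 'a set \<Rightarrow> 'a set" where
  "commutator_subgroup G H K =
     generate G {h \<otimes>\<^bsub>G\<^esub> k \<otimes>\<^bsub>G\<^esub> inv\<^bsub>G\<^esub> h \<otimes>\<^bsub>G\<^esub> inv\<^bsub>G\<^esub> k | h k. h \<in> H \<and> k \<in> K}"

primrec lower_central_series :: "('a, 'b) monoid_scheme \<Rightarrow> nat \<Rightarrow> 'a set" where
  "lower_central_series G 0 = carrier G"
| "lower_central_series G (Suc n) =
     commutator_subgroup G (lower_central_series G n) (carrier G)"

definition nilpotent_group :: "('a, 'b) monoid_scheme \<Rightarrow> bool" where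
  "nilpotent_group G \<longleftrightarrow> group G \<and> (\<exists>n. lower_central_series G n = {\<one>\<^bsub>G\<^esub>})"

text \<open>Intended for finite groups. The exponent 0 is allowed, so the trivial group is a
  p-group for every prime p.\<close>

definition p_group :: "nat \<Rightarrow> ('a, 'b) monoid_scheme \<Rightarrow> bool" where
  "p_group p G \<longleftrightarrow> group G \<and> (\<exists>k. order G = p ^ k)"


section \<open>Graphs\<close>

text \<open>An undirected simple graph is represented as a loop-free symmetric pair digraph: the edge
  between \<open>a\<close> and \<open>b\<close> is the pair of arcs \<open>(a, b)\<close>, \<open>(b, a)\<close>.\<close>

definition edge_difference :: "'a pair_pre_digraph \<Rightarrow> 'a pair_pre_digraph \<Rightarrow> 'a pair_pre_digraph" where
  "edge_difference X Y = \<lparr> pverts = pverts X, parcs = parcs X - parcs Y \<rparr>"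

definition isolated_vertex :: "'a pair_pre_digraph \<Rightarrow> 'a \<Rightarrow> bool" where
  "isolated_vertex X v \<longleftrightarrow>
     v \<in> pverts X \<and> (\<forall>w. (v, w) \<notin> parcs X \<and> (w, v) \<notin> parcs X)"

definition remove_isolated :: "'a pair_pre_digraph \<Rightarrow> 'a pair_pre_digraph" where
  "remove_isolated X =
     \<lparr> pverts = {v \<in> pverts X. \<not> isolated_vertex X v}, parcs = parcs X \<rparr>"

text \<open>The distance of two vertices is the least length of a walk between them, i.e. the
  shortest-path cost for unit weights, and is infinite if there is no walk. The constant \<open>wf_digraph.\<mu>\<close>
  comes from a locale, so its defining equation is available only when \<open>X\<close> is a \<open>wf_digraph\<close>;
  this is proved for the difference graph below.\<close>

definition graph_distance :: "('a, 'b) pre_digraph \<Rightarrow> 'a \<Rightarrow> 'a \<Rightarrow> ereal" where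
  "graph_distance X = wf_digraph.\<mu> X (\<lambda>_. 1)"

definition graph_diameter :: "('a, 'b) pre_digraph \<Rightarrow> ereal" where
  "graph_diameter X = (SUP (u, v) \<in> verts X \<times> verts X. graph_distance X u v)"


section \<open>Graphs of a group\<close>

definition power_graph :: "('a, 'b) monoid_scheme \<Rightarrow> 'a pair_pre_digraph" where
  "power_graph G =
     \<lparr> pverts = carrier G,
       parcs = {(a, b). a \<in> carrier G \<and> b \<in> carrier G \<and> a \<noteq> b \<and>
                        (a \<in> generate G {b} \<or> b \<in> generate G {a})} \<rparr>"

definition enhanced_power_graph :: "('a, 'b) monoid_scheme \<Rightarrow> 'a pair_pre_digraph" where
  "enhanced_power_graph G =
     \<lparr> pverts = carrier G,
       parcs = {(a, b). a \<in> carrier G \<and> b \<in> carrier G \<and> a \<noteq> b \<and>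
                        cyclic_group (subgroup_generated G {a, b})} \<rparr>"

definition difference_graph :: "('a, 'b) monoid_scheme \<Rightarrow> 'a pair_pre_digraph" where
  "difference_graph G =
     remove_isolated (edge_difference (enhanced_power_graph G) (power_graph G))"

lemma wf_digraph_difference_graph: "wf_digraph (with_proj (difference_graph G))"
  by unfold_locales
    (auto simp: difference_graph_def remove_isolated_def edge_difference_def
      enhanced_power_graph_def isolated_vertex_def)

lemma symmetric_difference_graph: "symmetric (with_proj (difference_graph G))"
  by (auto simp: symmetric_def sym_def difference_graph_def remove_isolated_def edge_difference_def
      enhanced_power_graph_def power_graph_def insert_commute)

lemma (in group) parcs_difference_graph:
  "(x, y) \<in> parcs (difference_graph G) \<longleftrightarrow>
     x \<in> carrier G \<and> y \<in> carrier G \<and> cyclic_group (subgroup_generated G {x, y}) \<and>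
     x \<notin> generate G {y} \<and> y \<notin> generate G {x}"
  by (auto simp: difference_graph_def remove_isolated_def edge_difference_def
      enhanced_power_graph_def power_graph_def intro: generate.incl)

end

theory Submission
  imports Defs "HOL-Algebra.Sylow" "HOL-Algebra.Multiplicative_Group"
begin

text \<open>Every vertex \<open>x\<close> of the difference graph has a neighbour of prime-power order, namely a
  prime-power part of any given neighbour of \<open>x\<close>. In a nilpotent group, nontrivial elements of coprime orders
  commute and hence are adjacent. Thus nontrivial elements of \<open>p\<close>-power and \<open>q\<close>-power order
  are adjacent if \<open>p \<noteq> q\<close>, and if \<open>p = q\<close> they have a common neighbour of \<open>r\<close>-power order for any other
  prime divisor \<open>r\<close> of the group order. So any two vertices are joined by a walk of length at most
  \<open>1 + 2 + 1\<close>.\<close>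

section \<open>Prime factors\<close>

text \<open>Splitting off the full power of \<open>p\<close> leaves a cofactor other than 1, and
  every prime divisor of that cofactor differs from \<open>p\<close>.\<close>

lemma exists_other_prime_divisor:
  fixes n :: nat
  assumes "prime p" "n > 0" "\<And>k. n \<noteq> p ^ k"
  obtains q where "prime q" "q \<noteq> p" "q dvd n"
proof -
  obtain k m where n: "\<not> p dvd m" "n = m * p ^ k"
    using prime_power_canonical[OF assms(1,2)] by blast
  then have "m \<noteq> 1"
    using assms(3)[of k] by auto
  then obtain q where q: "prime q" "q dvd m"
    using prime_factor_nat by blast
  show thesis
  proof
    show "q \<noteq> p" using q n by blast
    show "q dvd n" using q n by simp
  qed (rule q)
qed

section \<open>Elements of finite groups\<close>

text \<open>By Bezout, \<open>u * a + v * b = 1\<close> for some integers, so \<open>x\<close> is a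
  product of an integer power of \<open>x [^] a\<close> and one of \<open>x [^] b\<close>.\<close>

lemma (in group) subgroup_pow_coprime_closed:
  fixes a b :: nat
  assumes H: "subgroup H G" and x: "x \<in> carrier G"
    and ab: "coprime a b" "x [^] a \<in> H" "x [^] b \<in> H"
  shows "x \<in> H"
proof -
  obtain u v where uv: "u * int a + v * int b = 1"
    using ab(1) bezout_int[of "int a" "int b"] by auto
  have "x [^] (int a * u) \<in> H" "x [^] (int b * v) \<in> H"
    using subgroup_int_pow_closed[OF H ab(2), of u] subgroup_int_pow_closed[OF H ab(3), of v] x
    by (simp_all add: int_pow_pow flip: int_pow_int)
  then have "x [^] (int a * u) \<otimes> x [^] (int b * v) \<in> H"
    using H by (simp add: subgroup.m_closed)
  moreover have "x [^] (int a * u) \<otimes> x [^] (int b * v) = x"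
    using uv x by (simp add: mult.commute flip: int_pow_mult)
  ultimately show ?thesis by simp
qed

lemma (in group) generate_eq_range_int_pow:
  assumes "x \<in> carrier G"
  shows "generate G {x} = range (\<lambda>n::int. x [^] n)"
  unfolding generate_pow[OF assms] by blast

lemma (in group) generate_pow_mem:
  fixes k :: nat
  assumes "x \<in> carrier G"
  shows "x [^] k \<in> generate G {x}"
  unfolding generate_eq_range_int_pow[OF assms] by (metis int_pow_int rangeI)

text \<open>An element \<open>z\<close> of least order among those of \<open>generate G {y}\<close>
  outside \<open>H\<close> works: if its order had two coprime factors greater than 1, the
  corresponding powers of \<open>z\<close> would lie in \<open>H\<close>, and so would
  \<open>z\<close>.\<close>

lemma (in group) prime_power_element_not_in_subgroup:
  assumes fin: "finite (carrier G)" and H: "subgroup H G"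
    and y: "y \<in> carrier G" "y \<notin> H"
  obtains z p k where "z \<in> generate G {y}" "z \<notin> H" "prime p" "ord z = p ^ k"
proof -
  define P where "P z \<longleftrightarrow> z \<in> generate G {y} \<and> z \<notin> H" for z
  have "P y" using y by (simp add: P_def generate.incl)
  then obtain z where z: "P z" and least: "\<And>w. P w \<Longrightarrow> ord z \<le> ord w"
    by (metis exists_least_iff[of "\<lambda>n. \<exists>z. P z \<and> ord z = n"] not_le)
  have zG: "z \<in> carrier G"
    using z y(1) generate_in_carrier[of "{y}"] by (simp add: P_def)
  have pos: "ord z > 0"
    using ord_ge_1[OF fin zG] by simp
  have "z \<noteq> \<one>" using z H by (auto simp: P_def subgroup.one_closed)
  then have "ord z \<noteq> 1" using ord_eq_1[OF zG] by blast
  then obtain p where p: "prime p" "p dvd ord z"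
    using prime_factor_nat by blast
  obtain m k where m: "\<not> p dvd m" "ord z = m * p ^ k"
    using prime_power_canonical[OF p(1) pos] by blast
  have "m > 0" using pos m(2) by (cases m) auto
  have "k \<noteq> 0" using m p(2) by (cases k) auto
  then have pk: "p ^ k > 1"
    using one_less_power[OF prime_gt_1_nat[OF p(1)]] by blast
  \<comment> \<open>Raising \<open>z\<close> to a divisor \<open>d > 1\<close> of its order divides
    the order by \<open>d\<close> and stays in \<open>generate G {y}\<close>, so minimality leaves
    only \<open>H\<close>.\<close>
  have pow_in_H: "z [^] d \<in> H" if d: "d dvd ord z" "d > 1" for d
  proof (rule ccontr)
    assume "z [^] d \<notin> H"
    moreover have "z [^] d \<in> generate G {y}"
    proof -
      have "generate G {z} \<subseteq> generate G {y}"
        using z y(1) by (intro generate_subgroup_incl generate_is_subgroup) (auto simp: P_def)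
      then show ?thesis using generate_pow_mem[OF zG] by blast
    qed
    ultimately have "ord z \<le> ord (z [^] d)"
      using least by (simp add: P_def)
    moreover have "ord z div d < ord z"
      using d(2) pos by (rule div_less_dividend)
    ultimately show False
      using d zG by (simp add: ord_pow)
  qed
  have "m = 1"
  proof (rule ccontr)
    assume "m \<noteq> 1"
    with \<open>m > 0\<close> have "z [^] m \<in> H" by (intro pow_in_H) (auto simp: m(2))
    moreover have "z [^] (p ^ k) \<in> H" using pk by (intro pow_in_H) (auto simp: m(2))
    moreover have "coprime m (p ^ k)"
      using m(1) p(1) by (metis coprime_commute coprime_power_left_iff prime_imp_coprime)
    ultimately have "z \<in> H"
      using subgroup_pow_coprime_closed[OF H zG] by blast
    with z show False by (simp add: P_def)
  qed
  with m z p(1) that show thesis by (auto simp: P_def)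
qed

text \<open>Sylow's theorem with exponent 1 yields a subgroup of order \<open>q\<close>, as in
  Cauchy's theorem. The order of any of its nontrivial elements divides \<open>q\<close>.\<close>

lemma (in group) exists_prime_power_element:
  assumes fin: "finite (carrier G)" and q: "prime q" "q dvd order G"
  obtains z k where "z \<in> carrier G" "z \<noteq> \<one>" "ord z = q ^ k"
proof -
  obtain m where m: "order G = q ^ 1 * m"
    using q(2) by auto
  obtain H where H: "subgroup H G" "card H = q"
    using sylow_thm[OF q(1) is_group m fin] by auto
  have "H \<noteq> {\<one>}" using H(2) q(1) by auto
  then obtain z where z: "z \<in> H" "z \<noteq> \<one>"
    using subgroup.one_closed[OF H(1)] by blast
  have zG: "z \<in> carrier G" using subgroup.mem_carrier[OF H(1)] z by blast
  interpret S: group "G\<lparr>carrier := H\<rparr>" by (rule subgroup_imp_group[OF H(1)])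
  have "z [^] q = \<one>"
    using S.pow_order_eq_1[of z] z H(2) nat_pow_consistent[of z q H] by (simp add: order_def)
  then have "ord z dvd q" using zG by (simp add: pow_eq_id)
  then obtain k where "ord z = q ^ k" using q(1)
    by (metis power_0 power_one_right prime_nat_iff)
  with z zG that show thesis by blast
qed

text \<open>The order of an element of \<open>generate G {y}\<close> divides \<open>ord y\<close>;
  coprimality would then force \<open>ord x = 1\<close>.\<close>

lemma (in group) not_in_generate_if_coprime_ord:
  assumes xy: "x \<in> carrier G" "y \<in> carrier G" and "coprime (ord x) (ord y)" "x \<noteq> \<one>"
  shows "x \<notin> generate G {y}"
proof
  assume "x \<in> generate G {y}"
  then obtain k :: int where k: "x = y [^] k" using generate_pow[OF xy(2)] by blast
  have "x [^] int (ord y) = \<one>"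
    using xy(2) by (simp add: k int_pow_pow int_pow_eq_id)
  then have "int (ord x) dvd int (ord y)"
    using xy(1) by (simp add: int_pow_eq_id)
  then have "ord x = 1" using assms(3)
    by (metis coprime_common_divisor_nat dvd_refl int_dvd_int_iff)
  with assms show False using ord_eq_1 by blast
qed

section \<open>Cyclic subgroups\<close>

text \<open>The generator is \<open>c [^] d\<close> for the least positive \<open>d\<close> with
  \<open>c [^] d\<close> in \<open>H\<close>, or the identity if there is no such \<open>d\<close>.
  The order of \<open>c\<close> may be infinite here.\<close>

lemma (in group) subgroup_of_generate_singleton:
  assumes c: "c \<in> carrier G" and H: "subgroup H G" "H \<subseteq> generate G {c}"
  obtains d where "d \<in> carrier G" "H = generate G {d}"
proof (cases "\<exists>n::nat. n > 0 \<and> c [^] n \<in> H")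
  case True
  then obtain d :: nat where d: "d > 0" "c [^] d \<in> H"
    and least: "\<And>n. n < d \<Longrightarrow> \<not> (n > 0 \<and> c [^] n \<in> H)"
    by (metis exists_least_iff[of "\<lambda>n. n > 0 \<and> c [^] n \<in> H"])
  have "H \<subseteq> generate G {c [^] d}"
  proof
    fix h assume h: "h \<in> H"
    then obtain n :: int where n: "h = c [^] n" using H(2) generate_pow[OF c] by blast
    \<comment> \<open>Division with remainder: \<open>c [^] r\<close> is again in \<open>H\<close>
      and \<open>r < d\<close>, so minimality of \<open>d\<close> gives
      \<open>r = 0\<close>.\<close>
    define r where "r = nat (n mod int d)"
    have "c [^] r = h \<otimes> inv ((c [^] d) [^] (n div int d))"
    proof -
      have "c [^] r = c [^] (n - int d * (n div int d))"
        using d(1) by (simp add: r_def minus_mult_div_eq_mod int_pow_int flip: int_pow_int)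
      then show ?thesis using c by (simp add: int_pow_diff n int_pow_pow flip: int_pow_int)
    qed
    also have "\<dots> \<in> H"
      using H(1) h subgroup_int_pow_closed[OF H(1) d(2)]
      by (simp add: subgroup.m_closed subgroup.m_inv_closed)
    finally have "r = 0" using least[of r] d(1)
      by (auto simp: r_def nat_less_iff)
    then have "n mod int d = 0"
      using d(1) pos_mod_sign[of "int d" n] unfolding r_def by linarith
    then have "int d * (n div int d) = n"
      using mult_div_mod_eq[of "int d" n] by simp
    then have "h = (c [^] d) [^] (n div int d)"
      using c by (simp add: n int_pow_pow flip: int_pow_int)
    then show "h \<in> generate G {c [^] d}" using generate_pow[of "c [^] d"] c by auto
  qed
  moreover have "generate G {c [^] d} \<subseteq> H"
    using d(2) H(1) by (intro generate_subgroup_incl) auto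
  ultimately show ?thesis using that[of "c [^] d"] c by auto
next
  \<comment> \<open>With no positive power of \<open>c\<close> in \<open>H\<close>, taking inverses
    excludes the negative powers too, so \<open>H\<close> is trivial.\<close>
  case False
  have "h = \<one>" if h: "h \<in> H" for h
  proof -
    obtain n :: int where n: "h = c [^] n" using h H(2) generate_pow[OF c] by blast
    show ?thesis
    proof (cases n rule: int_cases2)
      case (nonneg k)
      then have "k = 0" using False n h by (auto simp: int_pow_int)
      then show ?thesis using n nonneg by simp
    next
      case (nonpos k)
      then have "c [^] k = inv h" using n c by (simp add: int_pow_neg int_pow_int)
      then have "c [^] k \<in> H" using h H(1) by (simp add: subgroup.m_inv_closed)
      then have "k = 0" using False by auto
      then show ?thesis using n nonpos by simp
    qed
  qed
  then have "H = {\<one>}" using subgroup.one_closed[OF H(1)] by blast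
  then show ?thesis using that[of \<one>] generate_one by simp
qed

text \<open>Cyclicity becomes containment in some cyclic subgroup of \<open>G\<close>, a condition
  that passes easily to powers of the elements of \<open>S\<close>. The backward direction rests on
  subgroups of cyclic groups being cyclic.\<close>

lemma (in group) cyclic_subgroup_generated_iff:
  assumes "S \<subseteq> carrier G"
  shows "cyclic_group (subgroup_generated G S) \<longleftrightarrow> (\<exists>c\<in>carrier G. S \<subseteq> generate G {c})"
proof
  interpret S: group "subgroup_generated G S" by simp
  have carr: "carrier (subgroup_generated G S) = generate G S"
    using assms by (simp add: carrier_subgroup_generated Int_absorb1)
  {
    assume "cyclic_group (subgroup_generated G S)"
    then obtain c where c: "c \<in> generate G S" "generate G S = range (\<lambda>n::int. c [^]\<^bsub>subgroup_generated G S\<^esub> n)"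
      using S.cyclic_group carr by auto
    have cG: "c \<in> carrier G" using c(1) assms generate_in_carrier by blast
    have "c \<in> carrier (subgroup_generated G S)" using c(1) carr by blast
    then have "generate G S = generate G {c}"
      unfolding c(2) generate_eq_range_int_pow[OF cG]
      by (intro image_cong refl int_pow_subgroup_generated)
    then show "\<exists>c\<in>carrier G. S \<subseteq> generate G {c}"
      using cG generate.incl[of _ S G] by blast
  next
    assume "\<exists>c\<in>carrier G. S \<subseteq> generate G {c}"
    then obtain c where c: "c \<in> carrier G" "S \<subseteq> generate G {c}" by blast
    have "generate G S \<subseteq> generate G {c}"
      using c by (intro generate_subgroup_incl generate_is_subgroup) auto
    then obtain d where d: "d \<in> carrier G" "generate G S = generate G {d}"
      using subgroup_of_generate_singleton[OF c(1) generate_is_subgroup[OF assms]] by blast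
    then have dS: "d \<in> carrier (subgroup_generated G S)"
      using carr generate.incl[of d "{d}" G] by simp
    \<comment> \<open>Integer powers of \<open>d\<close> agree in \<open>G\<close> and in the
      generated subgroup.\<close>
    have "carrier (subgroup_generated G S) = range (\<lambda>n::int. d [^]\<^bsub>subgroup_generated G S\<^esub> n)"
      unfolding carr d(2) generate_eq_range_int_pow[OF d(1)]
      by (intro image_cong refl int_pow_subgroup_generated[OF dS, symmetric])
    then show "cyclic_group (subgroup_generated G S)"
      using dS S.cyclic_group by blast
  }
qed

text \<open>The product \<open>x \<otimes> y\<close> generates both elements: its power with
  exponent \<open>ord y\<close> is \<open>x [^] ord y\<close>, and \<open>x [^] ord x\<close> is
  trivial, so coprimality of the exponents recovers \<open>x\<close>; likewise for
  \<open>y\<close>.\<close>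

lemma (in group) cyclic_subgroup_generated_coprime:
  assumes xy: "x \<in> carrier G" "y \<in> carrier G" "x \<otimes> y = y \<otimes> x" and "coprime (ord x) (ord y)"
  shows "cyclic_group (subgroup_generated G {x, y})"
proof -
  let ?H = "generate G {x \<otimes> y}"
  have H: "subgroup ?H G" using xy by (intro generate_is_subgroup) auto
  have pow: "(x \<otimes> y) [^] n = x [^] n \<otimes> y [^] n" for n :: nat
    using pow_mult_distrib xy by blast
  have "x [^] ord y = (x \<otimes> y) [^] ord y" "y [^] ord x = (x \<otimes> y) [^] ord x"
    unfolding pow using xy(1,2) by simp_all
  then have "x [^] ord y \<in> ?H" "y [^] ord x \<in> ?H"
    using generate_pow_mem xy(1,2) by simp_all
  moreover have "x [^] ord x \<in> ?H" "y [^] ord y \<in> ?H"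
    using xy H by (simp_all add: subgroup.one_closed)
  ultimately have "x \<in> ?H" "y \<in> ?H"
    using subgroup_pow_coprime_closed[OF H] xy assms(4) by blast+
  then show ?thesis
    using xy by (subst cyclic_subgroup_generated_iff) auto
qed

section \<open>Nilpotent groups\<close>

lemma (in group) commutator_eq_one_iff:
  assumes "x \<in> carrier G" "y \<in> carrier G"
  shows "x \<otimes> y \<otimes> inv x \<otimes> inv y = \<one> \<longleftrightarrow> x \<otimes> y = y \<otimes> x"
proof -
  have "x \<otimes> y \<otimes> inv x \<otimes> inv y = (x \<otimes> y) \<otimes> inv (y \<otimes> x)"
    using assms by (simp add: inv_mult_group m_assoc)
  then show ?thesis
    using assms by (metis inv_equality inv_inv m_closed inv_closed r_inv)
qed

text \<open>A conjugate of a commutator is the commutator of the conjugates, so each generating set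
  is closed under conjugation. Normality permits the passage to quotients below.\<close>

lemma (in group) normal_lower_central_series: "lower_central_series G n \<lhd> G"
proof (induction n)
  case 0
  then show ?case by (simp add: normal_invI subgroup_self)
next
  case (Suc n)
  let ?L = "lower_central_series G n"
  interpret L: normal ?L G by (rule Suc)
  show ?case
    unfolding lower_central_series.simps commutator_subgroup_def
  proof (rule normal_generateI)
    fix c g
    assume "c \<in> {h \<otimes> k \<otimes> inv h \<otimes> inv k |h k. h \<in> ?L \<and> k \<in> carrier G}" and g: "g \<in> carrier G"
    then obtain h k where c: "c = h \<otimes> k \<otimes> inv h \<otimes> inv k" "h \<in> ?L" "k \<in> carrier G"
      by blast
    have h: "h \<in> carrier G" using c(2) by (rule L.mem_carrier)
    \<comment> \<open>This removes the inner factors \<open>inv g \<otimes> g\<close> once the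
      product of conjugates is expanded.\<close>
    have cancel: "inv g \<otimes> (g \<otimes> z) = z" if "z \<in> carrier G" for z
      using that g by (simp flip: m_assoc)
    have "g \<otimes> c \<otimes> inv g =
        (g \<otimes> h \<otimes> inv g) \<otimes> (g \<otimes> k \<otimes> inv g) \<otimes> inv (g \<otimes> h \<otimes> inv g) \<otimes> inv (g \<otimes> k \<otimes> inv g)"
      using g h c(3) by (simp add: c(1) inv_mult_group m_assoc cancel)
    moreover have "g \<otimes> h \<otimes> inv g \<in> ?L" using c(2) g by (simp add: L.inv_op_closed2)
    ultimately show "g \<otimes> c \<otimes> inv g \<in> {h \<otimes> k \<otimes> inv h \<otimes> inv k |h k. h \<in> ?L \<and> k \<in> carrier G}"
      using g c(3) by blast
  qed (use L.mem_carrier in auto)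
qed

text \<open>Moving \<open>y\<close> past \<open>x [^] m\<close> collects \<open>c [^] m\<close>, so
  \<open>x [^] m = \<one>\<close> gives \<open>c [^] m = \<one>\<close>; symmetrically
  \<open>c [^] n = \<one>\<close>. Exponents replace orders because the lemma is applied to images
  in a quotient, whose orders may drop.\<close>

lemma (in group) central_commutator_coprime_eq_one:
  fixes m n :: nat
  assumes G: "x \<in> carrier G" "y \<in> carrier G" "c \<in> carrier G"
    and c: "x \<otimes> y = c \<otimes> (y \<otimes> x)" "c \<otimes> x = x \<otimes> c" "c \<otimes> y = y \<otimes> c"
    and pows: "x [^] m = \<one>" "y [^] n = \<one>" "coprime m n"
  shows "c = \<one>"
proof -
  have "x [^] k \<otimes> y = c [^] k \<otimes> (y \<otimes> x [^] k)" for k :: nat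
  proof (induction k)
    case (Suc k)
    have "x [^] Suc k \<otimes> y = x [^] k \<otimes> (c \<otimes> (y \<otimes> x))"
      using G by (simp add: m_assoc c(1))
    also have "\<dots> = c \<otimes> (x [^] k \<otimes> y) \<otimes> x"
      using G group_commutes_pow[OF c(2)[symmetric], of k] by (simp add: m_assoc flip: m_assoc[of _ c])
    also have "\<dots> = c [^] Suc k \<otimes> (y \<otimes> x [^] Suc k)"
      using G nat_pow_Suc2[of c k] by (simp add: Suc m_assoc del: nat_pow_Suc)
    finally show ?case .
  qed (use G in simp)
  from this[of m] have cm: "c [^] m = \<one>"
    using G pows(1) by (simp add: r_cancel_one')
  have "x \<otimes> y [^] k = c [^] k \<otimes> (y [^] k \<otimes> x)" for k :: nat
  proof (induction k)
    case (Suc k)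
    have "x \<otimes> y [^] Suc k = c [^] k \<otimes> (y [^] k \<otimes> (c \<otimes> (y \<otimes> x)))"
      using G by (simp add: m_assoc Suc flip: c(1)) (simp add: Suc flip: m_assoc)
    also have "y [^] k \<otimes> (c \<otimes> (y \<otimes> x)) = c \<otimes> (y [^] k \<otimes> (y \<otimes> x))"
      using G group_commutes_pow[OF c(3)[symmetric], of k] by (simp flip: m_assoc)
    also have "c [^] k \<otimes> \<dots> = c [^] Suc k \<otimes> (y [^] Suc k \<otimes> x)"
      using G by (simp add: m_assoc)
    finally show ?case .
  qed (use G in simp)
  from this[of n] have cn: "c [^] n = \<one>"
    using G pows(2) by (simp add: r_cancel_one')
  \<comment> \<open>The Bezout argument is applied to the trivial subgroup.\<close>
  have "subgroup {\<one>} G" by (rule triv_subgroup)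
  then show ?thesis
    using subgroup_pow_coprime_closed[OF _ G(3) pows(3)] cm cn by blast
qed

text \<open>Modulo the next term of the lower central series, the commutator \<open>c\<close> is central, so the order of its image
  divides both \<open>ord x\<close> and \<open>ord y\<close>.\<close>

lemma (in group) coprime_ord_commutator_in_lower_central_series:
  assumes x: "x \<in> carrier G" and y: "y \<in> carrier G" and cop: "coprime (ord x) (ord y)"
  shows "x \<otimes> y \<otimes> inv x \<otimes> inv y \<in> lower_central_series G n"
proof (induction n)
  case 0
  then show ?case using x y by simp
next
  case (Suc n)
  define c where "c = x \<otimes> y \<otimes> inv x \<otimes> inv y"
  define N where "N = lower_central_series G (Suc n)"
  interpret N: normal N G
    unfolding N_def by (rule normal_lower_central_series)
  interpret Q: group "G Mod N" by (rule N.factorgroup_is_group)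
  interpret f: group_hom G "G Mod N" "\<lambda>a. N #> a"
    using N.r_coset_hom_Mod by unfold_locales
  have c: "c \<in> carrier G" using x y by (simp add: c_def)
  have coset_one: "N #> a = \<one>\<^bsub>G Mod N\<^esub> \<longleftrightarrow> a \<in> N" if "a \<in> carrier G" for a
    using that N.rcos_const[OF is_group] rcos_self[OF that N.subgroup_axioms] by auto
  \<comment> \<open>By the induction hypothesis \<open>c\<close> lies in term \<open>n\<close> of
    the series, so its commutator with any \<open>g\<close> is one of the generators of
    \<open>N\<close>.\<close>
  have central: "(N #> c) \<otimes>\<^bsub>G Mod N\<^esub> (N #> g) = (N #> g) \<otimes>\<^bsub>G Mod N\<^esub> (N #> c)"
    if g: "g \<in> carrier G" for g
  proof -
    have "c \<otimes> g \<otimes> inv c \<otimes> inv g \<in> N"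
      using Suc g unfolding N_def c_def[symmetric]
      by (auto simp: commutator_subgroup_def intro: generate.incl)
    then have "N #> (c \<otimes> g \<otimes> inv c \<otimes> inv g) = \<one>\<^bsub>G Mod N\<^esub>"
      using c g by (subst coset_one) simp_all
    moreover have "N #> (c \<otimes> g \<otimes> inv c \<otimes> inv g) =
        (N #> c) \<otimes>\<^bsub>G Mod N\<^esub> (N #> g) \<otimes>\<^bsub>G Mod N\<^esub> inv\<^bsub>G Mod N\<^esub> (N #> c) \<otimes>\<^bsub>G Mod N\<^esub> inv\<^bsub>G Mod N\<^esub> (N #> g)"
      using c g f.hom_mult f.hom_inv m_closed inv_closed by metis
    ultimately show ?thesis
      using Q.commutator_eq_one_iff[OF f.hom_closed[OF c] f.hom_closed[OF g]] by metis
  qed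
  have "x \<otimes> y = c \<otimes> (y \<otimes> x)"
    using x y by (simp add: c_def m_assoc flip: m_assoc[of "inv y" y])
  then have "(N #> x) \<otimes>\<^bsub>G Mod N\<^esub> (N #> y) = (N #> c) \<otimes>\<^bsub>G Mod N\<^esub> ((N #> y) \<otimes>\<^bsub>G Mod N\<^esub> (N #> x))"
    using x y c by (metis f.hom_mult m_closed)
  moreover have "(N #> x) [^]\<^bsub>G Mod N\<^esub> ord x = \<one>\<^bsub>G Mod N\<^esub>" "(N #> y) [^]\<^bsub>G Mod N\<^esub> ord y = \<one>\<^bsub>G Mod N\<^esub>"
    using x y f.hom_nat_pow f.hom_one pow_ord_eq_1 by metis+
  ultimately have "N #> c = \<one>\<^bsub>G Mod N\<^esub>"
    using Q.central_commutator_coprime_eq_one[of "N #> x" "N #> y" "N #> c" "ord x" "ord y"]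
      central x y c cop f.hom_closed by blast
  then have "c \<in> N" using coset_one[OF c] by blast
  then show ?case by (simp only: c_def N_def)
qed

text \<open>The commutator lies in every term of the lower central series, in particular in the
  trivial one.\<close>

lemma (in group) nilpotent_coprime_ord_commute:
  assumes "nilpotent_group G" and xy: "x \<in> carrier G" "y \<in> carrier G" "coprime (ord x) (ord y)"
  shows "x \<otimes> y = y \<otimes> x"
proof -
  obtain n where "lower_central_series G n = {\<one>}"
    using assms(1) by (auto simp: nilpotent_group_def)
  then have "x \<otimes> y \<otimes> inv x \<otimes> inv y = \<one>"
    using coprime_ord_commutator_in_lower_central_series[OF xy, of n] by simp
  then show ?thesis using commutator_eq_one_iff xy by blast
qed

section \<open>The difference graph\<close>

lemma (in wf_digraph) awalk_cost_unit: "awalk_cost (\<lambda>_. 1) p = real (length p)"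
  by (induction p) simp_all

lemma connected_diameter_le:
  assumes "wf_digraph X" "symmetric X" "verts X \<noteq> {}"
    and walks: "\<And>u v. u \<in> verts X \<Longrightarrow> v \<in> verts X \<Longrightarrow>
      \<exists>p. pre_digraph.awalk X u p v \<and> length p \<le> n"
  shows "Digraph_Component.connected X \<and> graph_diameter X \<le> n"
proof
  interpret wf_digraph X by fact
  \<comment> \<open>Connectedness of a digraph is defined by reachability in its symmetric closure,
    together with a nonempty vertex set.\<close>
  have "u \<rightarrow>\<^sup>*\<^bsub>mk_symmetric X\<^esub> v" if "u \<in> verts X" "v \<in> verts X" for u v
    using walks[OF that] by (intro reachable_mk_symmetricI) (auto simp: reachable_awalk)
  then show "Digraph_Component.connected X"
    using assms(3) by (auto simp: Digraph_Component.connected_def)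
  have "graph_distance X u v \<le> n" if uv: "u \<in> verts X" "v \<in> verts X" for u v
  proof -
    obtain p where p: "awalk u p v" "length p \<le> n" using walks[OF uv] by blast
    have "graph_distance X u v \<le> awalk_cost (\<lambda>_. 1) p"
      unfolding graph_distance_def by (rule min_cost_le_walk_cost[OF p(1)])
    also have "\<dots> \<le> n" using p(2) by (simp add: awalk_cost_unit)
    finally show ?thesis .
  qed
  then show "graph_diameter X \<le> n"
    unfolding graph_diameter_def by (auto intro: SUP_least)
qed

context group
begin

lemma difference_graph_vertex_imp_neighbour:
  assumes "x \<in> pverts (difference_graph G)"
  obtains y where "(x, y) \<in> parcs (difference_graph G)"
  using assms symmetric_difference_graph[of G]
  by (auto simp: difference_graph_def remove_isolated_def isolated_vertex_def symmetric_def sym_def)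

lemma difference_graph_arc_sym:
  "(x, y) \<in> parcs (difference_graph G) \<Longrightarrow> (y, x) \<in> parcs (difference_graph G)"
  by (simp add: parcs_difference_graph insert_commute)

text \<open>Some prime-power part of a neighbour of \<open>x\<close> lies outside \<open>\<langle>x\<rangle>\<close>, and is therefore
  itself a neighbour of \<open>x\<close>.\<close>

lemma difference_graph_prime_power_neighbour:
  assumes fin: "finite (carrier G)" and "x \<in> pverts (difference_graph G)"
  obtains z p k where "(x, z) \<in> parcs (difference_graph G)" "prime p" "ord z = p ^ k" "z \<noteq> \<one>"
proof -
  obtain y where "(x, y) \<in> parcs (difference_graph G)"
    using assms(2) by (rule difference_graph_vertex_imp_neighbour)
  then have xy: "x \<in> carrier G" "y \<in> carrier G" "cyclic_group (subgroup_generated G {x, y})"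
    "x \<notin> generate G {y}" "y \<notin> generate G {x}"
    by (simp_all add: parcs_difference_graph)
  have X: "subgroup (generate G {x}) G" using xy by (intro generate_is_subgroup) auto
  obtain z p k where z: "z \<in> generate G {y}" "z \<notin> generate G {x}" "prime p" "ord z = p ^ k"
    using prime_power_element_not_in_subgroup[OF fin X xy(2,5)] .
  have zG: "z \<in> carrier G" using z(1) xy(2) generate_in_carrier[of "{y}"] by simp
  \<comment> \<open>Used twice: to place \<open>z\<close> in a cyclic subgroup containing
    \<open>x\<close> and \<open>y\<close>, and to see that \<open>x\<close> in
    \<open>generate G {z}\<close> would put \<open>x\<close> in
    \<open>generate G {y}\<close>.\<close>
  have gen_mono: "generate G {b} \<subseteq> generate G {a}" if "a \<in> carrier G" "b \<in> generate G {a}" for a b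
    using that by (intro generate_subgroup_incl generate_is_subgroup) auto
  obtain c where c: "c \<in> carrier G" "x \<in> generate G {c}" "y \<in> generate G {c}"
    using xy by (subst (asm) cyclic_subgroup_generated_iff) auto
  then have "z \<in> generate G {c}" using gen_mono z(1) by blast
  then have "cyclic_group (subgroup_generated G {x, z})"
    using c xy zG by (subst cyclic_subgroup_generated_iff) auto
  moreover have "x \<notin> generate G {z}"
    using gen_mono[OF xy(2) z(1)] xy(4) by blast
  ultimately have "(x, z) \<in> parcs (difference_graph G)"
    using xy z zG by (simp add: parcs_difference_graph)
  moreover have "z \<noteq> \<one>" using z(2) X by (auto simp: subgroup.one_closed)
  ultimately show thesis using that z by blast
qed

text \<open>Nilpotency makes the elements commute, so they generate a cyclic group, while
  coprimality excludes both memberships.\<close>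

lemma difference_graph_coprime_arc:
  assumes nil: "nilpotent_group G" and xy: "x \<in> carrier G" "y \<in> carrier G" "x \<noteq> \<one>" "y \<noteq> \<one>"
    and cop: "coprime (ord x) (ord y)"
  shows "(x, y) \<in> parcs (difference_graph G)"
proof -
  have "cyclic_group (subgroup_generated G {x, y})"
    using xy(1,2) nilpotent_coprime_ord_commute[OF nil xy(1,2) cop] cop
    by (rule cyclic_subgroup_generated_coprime)
  moreover have "x \<notin> generate G {y}"
    using not_in_generate_if_coprime_ord[OF xy(1,2) cop xy(3)] .
  moreover have "y \<notin> generate G {x}"
    using not_in_generate_if_coprime_ord[OF xy(2,1) _ xy(4)] cop coprime_commute by blast
  ultimately show ?thesis
    using xy by (simp add: parcs_difference_graph)
qed

text \<open>The case \<open>x = y\<close> is included on purpose: it gives \<open>x\<close> a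
  neighbour, which is how the graph is shown to have a vertex.\<close>

lemma difference_graph_prime_power_walk:
  assumes fin: "finite (carrier G)" and nil: "nilpotent_group G"
    and not_p_group: "\<not> (\<exists>p. prime p \<and> p_group p G)"
    and x: "x \<in> carrier G" "x \<noteq> \<one>" "prime p" "ord x = p ^ k"
    and y: "y \<in> carrier G" "y \<noteq> \<one>" "prime q" "ord y = q ^ l"
  shows "(x, y) \<in> parcs (difference_graph G) \<or>
    (\<exists>z. (x, z) \<in> parcs (difference_graph G) \<and> (z, y) \<in> parcs (difference_graph G))"
proof (cases "p = q")
  case False
  then have "coprime (ord x) (ord y)" using x y by (simp add: primes_coprime)
  then show ?thesis using difference_graph_coprime_arc[OF nil] x y by blast
next
  case True
  have "order G > 0" using fin by (simp add: order_gt_0_iff_finite)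
  moreover have "order G \<noteq> p ^ n" for n
    using not_p_group x(3) is_group by (auto simp: p_group_def)
  ultimately obtain r where r: "prime r" "r \<noteq> p" "r dvd order G"
    using exists_other_prime_divisor[OF x(3)] by blast
  obtain z m where z: "z \<in> carrier G" "z \<noteq> \<one>" "ord z = r ^ m"
    using exists_prime_power_element[OF fin r(1,3)] .
  have "coprime (ord x) (ord z)" "coprime (ord z) (ord y)"
    using x y z r True by (simp_all add: primes_coprime)
  then show ?thesis
    using difference_graph_coprime_arc[OF nil] x y z by blast
qed

lemma difference_graph_nonempty:
  assumes fin: "finite (carrier G)" and nil: "nilpotent_group G"
    and not_p_group: "\<not> (\<exists>p. prime p \<and> p_group p G)"
  shows "pverts (difference_graph G) \<noteq> {}"
proof -
  \<comment> \<open>A trivial group would be a 2-group with exponent 0, so some prime divides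
    \<open>order G\<close>.\<close>
  have "\<not> p_group 2 G"
    using not_p_group two_is_prime_nat by blast
  then have "order G \<noteq> 1"
    using is_group by (metis p_group_def power_0)
  then obtain p where p: "prime p" "p dvd order G"
    using prime_factor_nat by blast
  obtain x k where x: "x \<in> carrier G" "x \<noteq> \<one>" "ord x = p ^ k"
    using exists_prime_power_element[OF fin p] .
  obtain z where "(x, z) \<in> parcs (difference_graph G)"
    using difference_graph_prime_power_walk[OF assms x(1,2) p(1) x(3) x(1,2) p(1) x(3)] by blast
  then have "x \<in> pverts (difference_graph G)"
    using wf_digraph.tail_in_verts[OF wf_digraph_difference_graph[of G], of "(x, z)"] by simp
  then show ?thesis by blast
qed

end

theorem theorem3p3:
  fixes G :: "('a, 'b) monoid_scheme"
  assumes "group G"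
    and "finite (carrier G)"
    and "nilpotent_group G"
    and "\<not> (\<exists>p. prime p \<and> p_group p G)"
  shows "Digraph_Component.connected (with_proj (difference_graph G)) \<and>
         graph_diameter (with_proj (difference_graph G)) \<le> 4"
proof -
  interpret group G by fact
  let ?D = "difference_graph G"
  interpret D: wf_digraph "with_proj ?D" by (rule wf_digraph_difference_graph)
  have "\<exists>p. D.awalk x p y \<and> length p \<le> 4" if xy: "x \<in> pverts ?D" "y \<in> pverts ?D" for x y
  proof -
    obtain a p k where a: "(x, a) \<in> parcs ?D" "prime p" "ord a = p ^ k" "a \<noteq> \<one>\<^bsub>G\<^esub>"
      using difference_graph_prime_power_neighbour[OF assms(2) xy(1)] .
    obtain b q l where b: "(y, b) \<in> parcs ?D" "prime q" "ord b = q ^ l" "b \<noteq> \<one>\<^bsub>G\<^esub>"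
      using difference_graph_prime_power_neighbour[OF assms(2) xy(2)] .
    have "(b, y) \<in> parcs ?D" using b(1) by (rule difference_graph_arc_sym)
    moreover have "a \<in> carrier G" "b \<in> carrier G"
      using a(1) b(1) by (simp_all add: parcs_difference_graph)
    then consider "(a, b) \<in> parcs ?D" | z where "(a, z) \<in> parcs ?D" "(z, b) \<in> parcs ?D"
      using difference_graph_prime_power_walk[OF assms(2-4), of a p k b q l] a b by blast
    then show ?thesis
    \<comment> \<open>A direct arc between \<open>a\<close> and \<open>b\<close> gives a walk of
      length 3, and the detour through \<open>z\<close> one of length 4.\<close>
    proof cases
      case 1
      have "D.awalk x [(x, a), (a, b), (b, y)] y"
        using a(1) 1 \<open>(b, y) \<in> parcs ?D\<close> xy by (simp add: D.awalk_simps)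
      then show ?thesis by (intro exI conjI) auto
    next
      case 2
      have "D.awalk x [(x, a), (a, z), (z, b), (b, y)] y"
        using a(1) 2 \<open>(b, y) \<in> parcs ?D\<close> xy by (simp add: D.awalk_simps)
      then show ?thesis by (intro exI conjI) auto
    qed
  qed
  then show ?thesis
    using connected_diameter_le[OF wf_digraph_difference_graph symmetric_difference_graph, of G 4]
      difference_graph_nonempty[OF assms(2-4)] by simp
qed

end
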